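(* Let $T$ be a subcubic tree that is not isomorphic to the path $P_3$ on three vertices, let $v$ be a vertex of degree $2$ in $T$, and let $c\in\{\text{red},\text{blue}\}$. Then $T$ admits a crumby coloring in which $v$ receives color $c$.
   Context: A graph is subcubic if it has maximum degree at most $3$. A crumby coloring of a graph $H$ is a coloring of the vertices of $H$ with two colors, red and blue, such that the subgraph induced by the blue vertices has maximum degree at most $1$, and the subgraph induced by the red vertices has minimum degree at least $1$ and contains no path with $3$ edges. *)

theory Defs
  imports "Graph_Theory.Graph_Theory"
begin

text \<open>
  A finite simple undirected graph is a symmetric digraph without loops and parallel arcs, i.e. the
  locale predicate \<open>graph\<close> of \<open>Graph_Theory\<close>. An edge \<open>uv\<close> is represented by the two arcs \<open>u \<rightarrow> v\<close>
  and \<open>v \<rightarrow> u\<close>, so the undirected degree of a vertex is its \<open>out_degree\<close>, and a path with \<open>k\<close>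
  edges is an \<open>apath\<close> consisting of \<open>k\<close> arcs.
\<close>

definition max_degree_at_most :: "('a, 'b) pre_digraph \<Rightarrow> nat \<Rightarrow> bool" where
  "max_degree_at_most G k \<longleftrightarrow> (\<forall>u \<in> verts G. out_degree G u \<le> k)"

definition min_degree_at_least :: "('a, 'b) pre_digraph \<Rightarrow> nat \<Rightarrow> bool" where
  "min_degree_at_least G k \<longleftrightarrow> (\<forall>u \<in> verts G. k \<le> out_degree G u)"

definition subcubic :: "('a, 'b) pre_digraph \<Rightarrow> bool" where
  "subcubic G \<longleftrightarrow> max_degree_at_most G 3"

text \<open>
  The library predicate \<open>tree\<close> forbids all directed cycles. It is unusable here, because in a
  symmetric digraph each edge already gives a directed cycle \<open>u \<rightarrow> v \<rightarrow> u\<close>. In a \<open>graph\<close> the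
  undirected cycles are exactly the directed cycles of length at least 3.
\<close>

definition undirected_tree :: "('a, 'b) pre_digraph \<Rightarrow> bool" where
  "undirected_tree G \<longleftrightarrow>
     graph G \<and> connected G \<and> \<not> (\<exists>p. pre_digraph.cycle G p \<and> 3 \<le> length p)"

definition path_graph :: "nat \<Rightarrow> nat pair_pre_digraph" where
  "path_graph n =
     \<lparr> pverts = {..<n}, parcs = {(i, j). i < n \<and> j < n \<and> (j = Suc i \<or> i = Suc j)} \<rparr>"

definition contains_path :: "('a, 'b) pre_digraph \<Rightarrow> nat \<Rightarrow> bool" where
  "contains_path G k \<longleftrightarrow> (\<exists>u p w. pre_digraph.apath G u p w \<and> length p = k)"

datatype color = Red | Blue

definition color_subgraph :: "('a, 'b) pre_digraph \<Rightarrow> ('a \<Rightarrow> color) \<Rightarrow> color \<Rightarrow> ('a, 'b) pre_digraph" where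
  "color_subgraph G f c = G \<restriction> {u \<in> verts G. f u = c}"

text \<open>
  Only the values of \<open>f\<close> on \<open>verts G\<close> matter. Either color class may be empty; the degree
  conditions then hold vacuously.
\<close>

definition crumby_coloring :: "('a, 'b) pre_digraph \<Rightarrow> ('a \<Rightarrow> color) \<Rightarrow> bool" where
  "crumby_coloring G f \<longleftrightarrow>
     max_degree_at_most (color_subgraph G f Blue) 1 \<and>
     min_degree_at_least (color_subgraph G f Red) 1 \<and>
     \<not> contains_path (color_subgraph G f Red) 3"

end

theory Submission
  imports Defs
begin

text \<open>
  Root \<open>T\<close> at \<open>v\<close>. A vertex together with its descendants can be coloured so that only the root of
  that branch may still need, or exclude, a parent of a given kind; five states of the root describe
  all possibilities. Call a state attainable if it occurs for some colouring of the branch. Going up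
  the tree, every branch other than a single vertex keeps at least one of four minimal sets of
  attainable states. Combining the two branches at \<open>v\<close>, both colours of \<open>v\<close> are always possible
  unless both branches are single vertices, i.e. \<open>T\<close> is \<open>P\<^sub>3\<close>. States are then chosen from \<open>v\<close>
  downwards, and crumbiness is a local property of them.
\<close>

text \<open>
  Red components are stars. \<open>B0\<close>, \<open>B1\<close>: blue without, resp. with, a blue child. \<open>R0\<close>: red without a
  red child, so the parent must be the red centre of its star. \<open>Rc\<close>: red centre whose red children
  are leaves. \<open>Rl\<close>: red leaf attached to a child, so the parent must be blue.
\<close>

datatype state = B0 | B1 | R0 | Rc | Rl

section \<open>Compatibility of a state with the states of the children\<close>

text \<open>\<open>C\<close> stands for the children and \<open>g\<close> for their states. Demands
  on a parent are checked from above: \<open>R0\<close> is allowed only below \<open>Rc\<close>, and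
  \<open>Rl\<close> only below a blue state. A red component that is a single edge is read as
  \<open>Rc\<close> above \<open>R0\<close>.\<close>

fun consistent :: "state \<Rightarrow> 'a set \<Rightarrow> ('a \<Rightarrow> state) \<Rightarrow> bool" where
  "consistent B0 C g \<longleftrightarrow> (\<forall>x\<in>C. g x \<in> {Rc, Rl})"
| "consistent B1 C g \<longleftrightarrow> (\<exists>x\<in>C. g x = B0 \<and> (\<forall>y\<in>C - {x}. g y \<in> {Rc, Rl}))"
| "consistent R0 C g \<longleftrightarrow> (\<forall>x\<in>C. g x \<in> {B0, B1})"
| "consistent Rc C g \<longleftrightarrow> (\<exists>x\<in>C. g x = R0) \<and> (\<forall>x\<in>C. g x \<in> {B0, B1, R0})"
| "consistent Rl C g \<longleftrightarrow> (\<exists>x\<in>C. g x = Rc \<and> (\<forall>y\<in>C - {x}. g y \<in> {B0, B1}))"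

lemma consistent_cong:
  assumes "\<And>x. x \<in> C \<Longrightarrow> g x = h x"
  shows "consistent s C g \<longleftrightarrow> consistent s C h"
  using assms by (cases s) auto

lemma consistent_child:
  assumes "consistent s C g" "y \<in> C"
  shows "g y \<in> (case s of B0 \<Rightarrow> {Rc, Rl} | B1 \<Rightarrow> {B0, Rc, Rl} | R0 \<Rightarrow> {B0, B1}
    | Rc \<Rightarrow> {B0, B1, R0} | Rl \<Rightarrow> {B0, B1, Rc})"
  using assms by (cases s) auto

text \<open>\<open>B1\<close> and \<open>Rl\<close> are the states with one exceptional child, of
  the vertex's own colour. The equivalence says for both at once that all other children have the
  opposite colour.\<close>

lemma consistent_exceptional:
  assumes "consistent s C g" "s \<in> {B1, Rl}"
  shows "\<exists>w. \<forall>y\<in>C - {w}. g y \<in> {B0, B1} \<longleftrightarrow> s \<noteq> B1"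
proof (cases "s = B1")
  case True
  then obtain w where w: "\<forall>y\<in>C - {w}. g y \<in> {Rc, Rl}" using assms by auto
  have "g y \<notin> {B0, B1}" if "y \<in> C - {w}" for y using bspec[OF w that] by auto
  with True show ?thesis by blast
next
  case False
  then obtain w where "\<forall>y\<in>C - {w}. g y \<in> {B0, B1}" using assms by auto
  with False show ?thesis by (intro exI[of _ w]) auto
qed

section \<open>States attainable at the root of a branch\<close>

text \<open>An arbitrary child function keeps the case analysis free of graphs. Leaves need no base
  clause, since the premises about children are then vacuous.\<close>

inductive attainable :: "('a \<Rightarrow> 'a set) \<Rightarrow> 'a \<Rightarrow> state \<Rightarrow> bool" for ch where
  attainableI: "(\<And>x. x \<in> ch u \<Longrightarrow> attainable ch x (g x)) \<Longrightarrow> consistent s (ch u) g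
    \<Longrightarrow> attainable ch u s"

text \<open>
  The disjuncts of \<open>inner_shape\<close> are the minimal sets that arise by closing the attainable set
  \<open>{B0, R0}\<close> of a leaf under taking one or two ch.
\<close>

definition leaf_shape :: "(state \<Rightarrow> bool) \<Rightarrow> bool" where
  "leaf_shape P \<longleftrightarrow> P B0 \<and> P R0"

definition inner_shape :: "(state \<Rightarrow> bool) \<Rightarrow> bool" where
  "inner_shape P \<longleftrightarrow>
     P R0 \<and> P Rc \<or> P B0 \<and> P Rc \<or> P B1 \<and> P Rc \<and> P Rl \<or> P B0 \<and> P R0 \<and> P Rl"

lemma attainable_leaf: "ch u = {} \<Longrightarrow> leaf_shape (attainable ch u)"
  by (auto simp: leaf_shape_def intro: attainableI[where g="\<lambda>_. B0"])

lemma attainable_one: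
  assumes "ch u = {x}" "attainable ch x t" "consistent s {x} (\<lambda>_. t)"
  shows "attainable ch u s"
  by (rule attainableI[where g="\<lambda>_. t"]) (use assms in auto)

lemma attainable_two:
  assumes "ch u = {x, y}" "x \<noteq> y" "attainable ch x t" "attainable ch y t'"
    and "consistent s {x, y} ((\<lambda>_. t')(x := t))"
  shows "attainable ch u s"
  by (rule attainableI[where g="(\<lambda>_. t')(x := t)"]) (use assms in auto)

text \<open>The leaf shape leads to the first disjunct of \<open>inner_shape\<close>, the first to
  the second, the second and third to the fourth, and the fourth back to the first.\<close>

lemma inner_shape_one:
  assumes "ch u = {x}" "leaf_shape (attainable ch x) \<or> inner_shape (attainable ch x)"
  shows "inner_shape (attainable ch u)"
proof -
  note A = attainable_one[of ch u x, OF assms(1)]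
  have "attainable ch x B0 \<Longrightarrow> attainable ch u B1" "attainable ch x Rc \<Longrightarrow> attainable ch u B0"
    "attainable ch x Rl \<Longrightarrow> attainable ch u B0" "attainable ch x B0 \<Longrightarrow> attainable ch u R0"
    "attainable ch x B1 \<Longrightarrow> attainable ch u R0" "attainable ch x R0 \<Longrightarrow> attainable ch u Rc"
    "attainable ch x Rc \<Longrightarrow> attainable ch u Rl"
    by (erule A, simp)+
  with assms(2) show ?thesis
    unfolding leaf_shape_def inner_shape_def by blast
qed

lemma attainable_two_cases:
  fixes ch u defines "A \<equiv> attainable ch"
  assumes "ch u = {x, y}" "x \<noteq> y"
  shows "\<lbrakk>A x Rc \<or> A x Rl; A y Rc \<or> A y Rl\<rbrakk> \<Longrightarrow> A u B0"
    and "\<lbrakk>A x B0; A y Rc \<or> A y Rl\<rbrakk> \<Longrightarrow> A u B1"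
    and "\<lbrakk>A x B0 \<or> A x B1; A y B0 \<or> A y B1\<rbrakk> \<Longrightarrow> A u R0"
    and "\<lbrakk>A x R0; A y B0 \<or> A y B1 \<or> A y R0\<rbrakk> \<Longrightarrow> A u Rc"
    and "\<lbrakk>A x Rc; A y B0 \<or> A y B1\<rbrakk> \<Longrightarrow> A u Rl"
  unfolding A_def
  by - (elim disjE; (rule attainable_two[of ch u x y, OF assms(2,3)], assumption, assumption,
        simp add: assms(3) assms(3)[symmetric] ex_disj_distrib))+

text \<open>Red root: a shape without a blue state contains \<open>R0\<close> and \<open>Rc\<close>,
  and every shape contains one of these two, so some pair of child states yields \<open>Rc\<close>
  or \<open>Rl\<close>. Blue root: an inner shape at \<open>x\<close> offers \<open>Rc\<close> or
  \<open>Rl\<close>, while \<open>y\<close> offers \<open>B0\<close>, which gives \<open>B1\<close>,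
  or \<open>Rc\<close>, which gives \<open>B0\<close>. Two leaves offer no such pair.\<close>

lemma attainable_two_shapes:
  assumes "ch u = {x, y}" "x \<noteq> y"
    and "leaf_shape (attainable ch x) \<or> inner_shape (attainable ch x)"
    and "leaf_shape (attainable ch y) \<or> inner_shape (attainable ch y)"
  shows inner_shape_two: "inner_shape (attainable ch u)"
    and root_red: "attainable ch u Rc \<or> attainable ch u Rl"
    and root_blue: "inner_shape (attainable ch x) \<Longrightarrow> attainable ch u B0 \<or> attainable ch u B1"
proof -
  have *: "ch u = {y, x}" "y \<noteq> x" using assms by auto
  \<comment> \<open>Most cases treat the two children asymmetrically, so they are also taken with
    \<open>x\<close> and \<open>y\<close> exchanged.\<close>
  note A = attainable_two_cases[of ch u x y, OF assms(1,2)]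
    attainable_two_cases[of ch u y x, OF *]
  show "inner_shape (attainable ch u)" "attainable ch u Rc \<or> attainable ch u Rl"
    "inner_shape (attainable ch x) \<Longrightarrow> attainable ch u B0 \<or> attainable ch u B1"
    using assms(3,4) A unfolding leaf_shape_def inner_shape_def by argo+
qed

section \<open>Rooted trees as layered edge relations\<close>

text \<open>Acyclicity enters only through the depth \<open>d\<close>: edges join consecutive layers
  and parents are unique.\<close>

locale layered_tree =
  fixes V :: "'a set" and E :: "'a rel" and r :: 'a and d :: "'a \<Rightarrow> nat"
  assumes finite_V: "finite V"
    and E_subset: "E \<subseteq> V \<times> V"
    and sym_E: "(x, y) \<in> E \<Longrightarrow> (y, x) \<in> E"
    and r_in_V: "r \<in> V"
    and d_r: "d r = 0"
    and layer: "(x, y) \<in> E \<Longrightarrow> d x = Suc (d y) \<or> d y = Suc (d x)"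
    and parent_ex: "x \<in> V \<Longrightarrow> x \<noteq> r \<Longrightarrow> \<exists>p. (p, x) \<in> E \<and> d x = Suc (d p)"
    and parent_unique: "(p, x) \<in> E \<Longrightarrow> (q, x) \<in> E \<Longrightarrow> d x = Suc (d p) \<Longrightarrow> d x = Suc (d q) \<Longrightarrow> p = q"
begin

definition children :: "'a \<Rightarrow> 'a set" where
  "children x = {y. (x, y) \<in> E \<and> d y = Suc (d x)}"

definition parent :: "'a \<Rightarrow> 'a" where
  "parent x = (SOME p. x \<in> children p)"

lemma parent_eq: "x \<in> children p \<Longrightarrow> parent x = p"
  unfolding parent_def by (rule some_equality) (auto simp: children_def intro: parent_unique)

lemma ex_parent: "x \<in> V \<Longrightarrow> x \<noteq> r \<Longrightarrow> \<exists>p\<in>V. x \<in> children p"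
  using parent_ex E_subset by (fastforce simp: children_def)

lemma root_not_child: "r \<notin> children p"
  using d_r by (auto simp: children_def)

lemma E_cases:
  assumes "(x, y) \<in> E" shows "y \<in> children x \<or> x \<in> children y"
  using layer[OF assms] assms sym_E by (auto simp: children_def)

lemma children_subset: "children x \<subseteq> V"
  using E_subset by (auto simp: children_def)

text \<open>Attainability supplies witnesses one level at a time; choosing them from the root
  downwards glues them into one labelling, as every vertex has a single parent.\<close>

lemma labelling:
  assumes "attainable children r s"
  shows "\<exists>L. L r = s \<and> (\<forall>x\<in>V. consistent (L x) (children x) L)"
proof -
  obtain G where G: "\<And>u s. attainable children u s 
      \<Longrightarrow> consistent s (children u) (G u s) \<and> (\<forall>x\<in>children u. attainable children x (G u s x))"
  proof -
    have "\<exists>g. attainable children u s \<longrightarrow>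
        consistent s (children u) g \<and> (\<forall>x\<in>children u. attainable children x (g x))" for u s
      by (meson attainable.cases)
    then show ?thesis using that by metis
  qed
  \<comment> \<open>\<open>F n\<close> is meant for depth \<open>n\<close>: a vertex gets the state
    that the witness chosen for its parent assigns to it. Only the value at index \<open>d x\<close>
    is used.\<close>
  define F where "F = rec_nat (\<lambda>_. s) (\<lambda>_ h x. G (parent x) (h (parent x)) x)"
  define L where "L x = F (d x) x" for x
  have L_r: "L r = s" by (simp add: L_def F_def d_r)
  have L_ch: "L x = G u (L u) x" if "x \<in> children u" for x u
  proof -
    have "d x = Suc (d u)" using that by (simp add: children_def)
    then show ?thesis using parent_eq[OF that] by (simp add: L_def F_def)
  qed
  have "x \<in> V \<Longrightarrow> attainable children x (L x)" for x
  proof (induction "d x" arbitrary: x)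
    case 0
    then show ?case using assms L_r parent_ex[of x] by fastforce
  next
    case (Suc n)
    then obtain p where "p \<in> V" "x \<in> children p" using ex_parent d_r by (metis nat.distinct(1))
    moreover from this have "attainable children p (L p)" using Suc by (auto simp: children_def)
    ultimately show ?case using G[of p "L p"] L_ch[of x p] by simp
  qed
  then have "consistent (L x) (children x) (G x (L x))" if "x \<in> V" for x
    using G that by blast
  then have "consistent (L x) (children x) L" if "x \<in> V" for x
    using consistent_cong[of "children x" L "G x (L x)" "L x"] L_ch that by blast
  with L_r show ?thesis by (intro exI[of _ L]) blast
qed

definition state_color :: "('a \<Rightarrow> state) \<Rightarrow> 'a \<Rightarrow> color" where
  "state_color L x = (if L x \<in> {B0, B1} then Blue else Red)"

section \<open>Crumbiness of the colouring given by a consistent labelling\<close>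

context
  fixes L
  assumes L: "\<And>x. x \<in> V \<Longrightarrow> consistent (L x) (children x) L" and root: "L r \<noteq> R0"
begin

lemma blue_child:
  assumes "y \<in> children x" "x \<in> V" "state_color L x = Blue" "state_color L y = Blue"
  shows "L x = B1" "L y = B0"
  using consistent_child[OF L[OF assms(2)] assms(1)] assms(3,4)
  by (auto simp: state_color_def split: if_splits state.splits)

lemma red_child:
  assumes "y \<in> children x" "x \<in> V" "state_color L x = Red" "state_color L y = Red"
  shows "L x = Rc \<and> L y = R0 \<or> L x = Rl \<and> L y = Rc"
  using consistent_child[OF L[OF assms(2)] assms(1)] assms(3,4)
  by (auto simp: state_color_def split: if_splits state.splits)

lemma child_unique:
  assumes "y \<in> children x" "z \<in> children x" "x \<in> V" "L x \<in> {B1, Rl}"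
    and "state_color L y = state_color L x" "state_color L z = state_color L x"
  shows "y = z"
proof -
  obtain w where w: "\<forall>y\<in>children x - {w}. L y \<in> {B0, B1} \<longleftrightarrow> L x \<noteq> B1"
    using consistent_exceptional[OF L[OF assms(3)] assms(4)] by (rule exE)
  have "state_color L u \<noteq> state_color L x" if "u \<in> children x" "u \<noteq> w" for u
    using bspec[OF w, of u] that assms(4) unfolding state_color_def by auto
  then show ?thesis using assms by metis
qed

text \<open>In a blue edge the upper end is \<open>B1\<close> and the lower end \<open>B0\<close>,
  so \<open>x\<close> cannot have blue edges both above and below. Two below contradict the single
  exceptional child, two above the unique parent.\<close>

lemma blue_unique:
  assumes "(x, y) \<in> E" "(x, z) \<in> E" "state_color L x = Blue" "state_color L y = Blue" "state_color L z = Blue"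
  shows "y = z"
proof -
  have V: "x \<in> V" "y \<in> V" "z \<in> V" using assms E_subset by auto
  from E_cases[OF assms(1)] E_cases[OF assms(2)] show ?thesis
  proof (elim disjE)
    assume c: "y \<in> children x" "z \<in> children x"
    have "L x = B1" using blue_child(1)[OF c(1) V(1)] assms by simp
    then show ?thesis using child_unique[OF c V(1)] assms by simp
  next
    assume c: "y \<in> children x" "x \<in> children z"
    show ?thesis using blue_child(1)[OF c(1) V(1)] blue_child(2)[OF c(2) V(3)] assms by simp
  next
    assume c: "x \<in> children y" "z \<in> children x"
    show ?thesis using blue_child(2)[OF c(1) V(2)] blue_child(1)[OF c(2) V(1)] assms by simp
  next
    assume "x \<in> children y" "x \<in> children z"
    then show ?thesis using parent_eq by metis
  qed
qed

text \<open>\<open>Rc\<close> and \<open>Rl\<close> have a red child; \<open>R0\<close> relies on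
  its parent, which is why it is excluded at the root.\<close>

lemma red_ex:
  assumes "x \<in> V" "state_color L x = Red"
  shows "\<exists>y. (x, y) \<in> E \<and> state_color L y = Red"
proof (cases "L x = R0")
  case True
  then have "x \<noteq> r" using root by auto
  with ex_parent assms obtain p where p: "p \<in> V" "x \<in> children p" by blast
  then have "(x, p) \<in> E" by (auto simp: children_def intro: sym_E)
  moreover have "state_color L p = Red"
    using consistent_child[OF L[OF p(1)] p(2)] True by (auto simp: state_color_def split: state.splits)
  ultimately show ?thesis by blast
next
  case False
  then have "\<exists>y\<in>children x. state_color L y = Red"
    using L[OF assms(1)] assms(2) by (cases "L x"; force simp: state_color_def)
  then show ?thesis by (auto simp: children_def)
qed

text \<open>These states mark the leaves of red stars. A red child forces \<open>Rl\<close> and a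
  red parent forces \<open>R0\<close>, so the red neighbours lie all below or all above
  \<open>x\<close>.\<close>

lemma red_unique:
  assumes "(x, y) \<in> E" "(x, z) \<in> E" "L x \<in> {R0, Rl}" "state_color L y = Red" "state_color L z = Red"
  shows "y = z"
proof -
  have V: "x \<in> V" "y \<in> V" "z \<in> V" using assms E_subset by auto
  have red: "state_color L x = Red" using assms(3) by (auto simp: state_color_def)
  from E_cases[OF assms(1)] E_cases[OF assms(2)] show ?thesis
  proof (elim disjE)
    assume c: "y \<in> children x" "z \<in> children x"
    have "L x = Rl" using red_child[OF c(1) V(1)] red assms by auto
    then show ?thesis using child_unique[OF c V(1)] red assms by simp
  next
    assume c: "y \<in> children x" "x \<in> children z"
    show ?thesis using red_child[OF c(1) V(1)] red_child[OF c(2) V(3)] red assms by auto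
  next
    assume c: "x \<in> children y" "z \<in> children x"
    show ?thesis using red_child[OF c(1) V(2)] red_child[OF c(2) V(1)] red assms by auto
  next
    assume "x \<in> children y" "x \<in> children z"
    then show ?thesis using parent_eq by metis
  qed
qed

text \<open>Two vertices in state \<open>Rc\<close> are never adjacent, so every red edge contains a
  leaf of its star.\<close>

lemma red_edge:
  assumes "(x, y) \<in> E" "state_color L x = Red" "state_color L y = Red"
  shows "L x \<in> {R0, Rl} \<or> L y \<in> {R0, Rl}"
proof -
  have "x \<in> V" "y \<in> V" using assms E_subset by auto
  then show ?thesis using E_cases[OF assms(1)] red_child assms(2,3) by blast
qed

end

section \<open>Shapes of branches and labellings of the whole tree\<close>

lemma card_children:
  assumes "card {y. (x, y) \<in> E} \<le> 3" "x \<in> V" "x \<noteq> r"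
  shows "finite (children x)" "card (children x) \<le> 2"
proof -
  have fin: "finite {y. (x, y) \<in> E}"
    by (rule finite_subset[OF _ finite_V]) (use E_subset in auto)
  obtain p where "x \<in> children p" using ex_parent assms by blast
  then have "p \<in> {y. (x, y) \<in> E}" "p \<notin> children x" by (auto simp: children_def intro: sym_E)
  then have "children x \<subset> {y. (x, y) \<in> E}" by (auto simp: children_def)
  from psubset_card_mono[OF fin this] assms show "card (children x) \<le> 2" by simp
  show "finite (children x)" by (rule finite_subset[OF children_subset finite_V])
qed

lemma leaf_or_inner_shape:
  assumes deg: "\<And>x. x \<in> V \<Longrightarrow> card {y. (x, y) \<in> E} \<le> 3" and "x \<in> V" "x \<noteq> r"
  shows "if children x = {} then leaf_shape (attainable children x) else inner_shape (attainable children x)"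
  using assms(2,3)
\<comment> \<open>The measure counts layers up to the deepest one, so the induction runs from the
  children to their parent.\<close>
proof (induction "Max (d ` V) - d x" arbitrary: x rule: less_induct)
  case less
  have ch_shape: "leaf_shape (attainable children y) \<or> inner_shape (attainable children y)" if "y \<in> children x" for y
  proof -
    have y: "y \<in> V" "y \<noteq> r" "d y = Suc (d x)"
      using that root_not_child children_subset by (auto simp: children_def)
    have "d y \<le> Max (d ` V)" by (rule Max_ge) (use finite_V y(1) in auto)
    with y have "Max (d ` V) - d y < Max (d ` V) - d x" by linarith
    from less(1)[OF this y(1,2)] show ?thesis by metis
  qed
  have "finite (children x)" "card (children x) \<le> 2" using card_children[OF deg] less.prems by auto
  then consider "children x = {}" | a where "children x = {a}" | a b where "children x = {a, b}" "a \<noteq> b"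
    by (metis card_0_eq card_1_singletonE card_2_iff le_SucE le_zero_eq numeral_2_eq_2 One_nat_def)
  then show ?case
  proof cases
    case 1
    then show ?thesis by (simp add: attainable_leaf)
  next
    case 2
    then show ?thesis using inner_shape_one[of children x a] ch_shape by auto
  next
    case 3
    then show ?thesis using inner_shape_two[of children x a b] ch_shape by auto
  qed
qed

text \<open>Identifies the exceptional tree: a vertex of depth at least two would have an ancestor
  among the children of \<open>r\<close> that is not a leaf.\<close>

lemma star_if_leaves:
  assumes "\<And>y. y \<in> children r \<Longrightarrow> children y = {}"
  shows "V = insert r (children r)" "E = {r} \<times> children r \<union> children r \<times> {r}"
proof -
  have V: "x \<in> V \<Longrightarrow> x \<in> insert r (children r)" for x
  proof (induction "d x" arbitrary: x rule: less_induct)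
    case less
    show ?case
    proof (cases "x = r")
      case False
      then obtain p where p: "p \<in> V" "x \<in> children p" using ex_parent less.prems by blast
      then have "p \<in> insert r (children r)" by (intro less.hyps) (auto simp: children_def)
      then show ?thesis using p(2) assms by blast
    qed simp
  qed
  then show "V = insert r (children r)" using r_in_V children_subset by blast
  have "y \<in> children x \<Longrightarrow> x \<in> V \<Longrightarrow> x = r" for x y using V assms by blast
  then have "(x, y) \<in> E \<Longrightarrow> (x, y) \<in> {r} \<times> children r \<union> children r \<times> {r}" for x y
    using E_cases[of x y] E_subset by blast
  moreover have "y \<in> children r \<Longrightarrow> (r, y) \<in> E \<and> (y, r) \<in> E" for y
    by (auto simp: children_def intro: sym_E)
  ultimately show "E = {r} \<times> children r \<union> children r \<times> {r}" by auto
qed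

lemma children_root: "children r = {y. (r, y) \<in> E}"
  using layer d_r by (force simp: children_def)

text \<open>One branch with more than one vertex suffices: its inner shape makes a blue root
  attainable, while a red root other than \<open>R0\<close> is attainable in any case.\<close>

lemma ex_root_labelling:
  assumes deg: "\<And>x. x \<in> V \<Longrightarrow> card {y. (x, y) \<in> E} \<le> 3"
    and r: "card {y. (r, y) \<in> E} = 2"
    and inner: "y \<in> children r" "children y \<noteq> {}"
  shows "\<exists>L. (\<forall>x\<in>V. consistent (L x) (children x) L) \<and> L r \<noteq> R0 \<and> state_color L r = c"
proof -
  obtain z where ch_r: "children r = {y, z}" "y \<noteq> z"
    using children_root r inner(1) by (metis card_2_iff doubleton_eq_iff insertE singletonD)
  have shape_ch: "if children x = {} then leaf_shape (attainable children x)
      else inner_shape (attainable children x)" if "x \<in> children r" for x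
    using leaf_or_inner_shape[OF deg] that root_not_child children_subset by blast
  have y: "inner_shape (attainable children y)"
    and z: "leaf_shape (attainable children z) \<or> inner_shape (attainable children z)"
    using shape_ch[of y] shape_ch[of z] ch_r inner by (auto split: if_splits)
  have "\<exists>s. attainable children r s \<and> s \<noteq> R0 \<and> (s \<in> {B0, B1} \<longleftrightarrow> c = Blue)"
    using root_red[OF ch_r _ z] root_blue[OF ch_r _ z] y by (cases c) fastforce+
  then obtain s where s: "attainable children r s" "s \<noteq> R0" "s \<in> {B0, B1} \<longleftrightarrow> c = Blue" by blast
  from labelling[OF s(1)] obtain L where "L r = s" "\<forall>x\<in>V. consistent (L x) (children x) L" by blast
  with s show ?thesis by (intro exI[of _ L]) (cases c; auto simp: state_color_def)
qed

end

section \<open>Crumbiness and distance layers in digraphs\<close>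

context graph
begin

lemma out_degree_conv: "out_degree G x = card {y. x \<rightarrow> y}"
proof -
  have "bij_betw (head G) (out_arcs G x) {y. x \<rightarrow> y}"
    unfolding bij_betw_def
    by (auto simp: inj_on_def arc_to_ends_def arcs_ends_conv intro: no_multi_arcs)
  then show ?thesis unfolding out_degree_def by (rule bij_betw_same_card)
qed

lemma dominates_sym: "x \<rightarrow> y \<Longrightarrow> y \<rightarrow> x"
  using sym_arcs by (rule arcs_ends_symmetric)

lemma dominates_arc: "e \<in> arcs G \<Longrightarrow> tail G e \<rightarrow> head G e"
  by (auto simp: arcs_ends_conv)

text \<open>The last condition speaks of red walks; on a path with three edges the vertices are
  distinct, so neither equality can hold.\<close>

lemma crumby_coloringI:
  assumes blue: "\<And>x y z. \<lbrakk>x \<rightarrow> y; x \<rightarrow> z; f x = Blue; f y = Blue; f z = Blue\<rbrakk> \<Longrightarrow> y = z"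
    and red: "\<And>x. \<lbrakk>x \<in> verts G; f x = Red\<rbrakk> \<Longrightarrow> \<exists>y. x \<rightarrow> y \<and> f y = Red"
    and red_edge: "\<And>w x y z. \<lbrakk>w \<rightarrow> x; x \<rightarrow> y; y \<rightarrow> z; f w = Red; f x = Red; f y = Red; f z = Red\<rbrakk>
      \<Longrightarrow> w = y \<or> x = z"
  shows "crumby_coloring G f"
proof -
  have "out_degree (color_subgraph G f Blue) x \<le> 1" for x
  proof -
    have "e = e'" if e: "e \<in> out_arcs (color_subgraph G f Blue) x"
        and e': "e' \<in> out_arcs (color_subgraph G f Blue) x" for e e'
    proof -
      have "head G e = head G e'"
        by (rule blue[of x]) (use e e' dominates_arc[of e] dominates_arc[of e'] in \<open>auto simp: color_subgraph_def\<close>)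
      then show ?thesis
        using e e' by (intro no_multi_arcs) (auto simp: color_subgraph_def arc_to_ends_def)
    qed
    moreover have "finite (out_arcs (color_subgraph G f Blue) x)"
      by (rule finite_subset[OF _ finite_arcs]) (auto simp: color_subgraph_def)
    ultimately show ?thesis
      unfolding out_degree_def by (simp add: card_le_Suc0_iff_eq)
  qed
  moreover have "1 \<le> out_degree (color_subgraph G f Red) x" if x: "x \<in> verts G" "f x = Red" for x
  proof -
    obtain y where y: "x \<rightarrow> y" "f y = Red" using red x by blast
    then obtain e where "e \<in> arcs G" "tail G e = x" "head G e = y" by (auto simp: arcs_ends_conv)
    with x y have "e \<in> out_arcs (color_subgraph G f Red) x"
      using adj_in_verts(2) by (auto simp: color_subgraph_def)
    moreover have "finite (out_arcs (color_subgraph G f Red) x)"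
      by (rule finite_subset[OF _ finite_arcs]) (auto simp: color_subgraph_def)
    ultimately show ?thesis
      unfolding out_degree_def by (metis One_nat_def Suc_leI card_gt_0_iff empty_iff)
  qed
  moreover have "\<not> contains_path (color_subgraph G f Red) 3"
  proof
    assume "contains_path (color_subgraph G f Red) 3"
    then obtain u p w where p: "pre_digraph.apath (color_subgraph G f Red) u p w" "length p = 3"
      by (auto simp: contains_path_def)
    then obtain a b c where "p = [a, b, c]"
      by (auto simp: numeral_3_eq_3 length_Suc_conv)
    with p(1) show False
      using red_edge[of "tail G a" "head G a" "head G b" "head G c"]
        dominates_arc[of a] dominates_arc[of b] dominates_arc[of c]
      by (auto simp: color_subgraph_def pre_digraph.apath_def pre_digraph.awalk_def
          pre_digraph.cas.simps pre_digraph.awalk_verts.simps)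
  qed
  ultimately show ?thesis
    unfolding crumby_coloring_def max_degree_at_most_def min_degree_at_least_def
    by (auto simp: color_subgraph_def)
qed

text \<open>The layers are the distances from \<open>v\<close>. An edge inside a layer and a second
  parent both give some vertex two neighbours no farther from \<open>v\<close> than itself, which
  \<open>unique\<close> excludes.\<close>

lemma layered_tree_distance:
  assumes conn: "connected G" and acyclic: "\<not> (\<exists>p. cycle p \<and> 3 \<le> length p)" and v: "v \<in> verts G"
  shows "\<exists>d. layered_tree (verts G) (arcs_ends G) v d"
proof -
  define d where "d x = (LEAST n. (v, x) \<in> arcs_ends G ^^ n)" for x
  have reach: "(v, x) \<in> arcs_ends G ^^ d x" if "x \<in> verts G" for x
  proof -
    have "v \<rightarrow>\<^sup>* x"
      using symmetric_connected_imp_strongly_connected[OF sym_arcs conn] v that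
      by (auto simp: strongly_connected_def)
    then have "\<exists>n. (v, x) \<in> arcs_ends G ^^ n"
      using reachable_rtranclI rtrancl_power by metis
    then show ?thesis unfolding d_def by (rule LeastI_ex)
  qed
  have d_le: "d x \<le> n" if "(v, x) \<in> arcs_ends G ^^ n" for x n
    unfolding d_def using that by (rule Least_le)
  have d_v: "d v = 0" using d_le[of v 0] by simp
  have d_step: "d y \<le> Suc (d x)" if "x \<rightarrow> y" for x y
    using d_le relpow_Suc_I[OF reach that] adj_in_verts[OF that] by blast
  have parent: "\<exists>p. p \<rightarrow> x \<and> d x = Suc (d p)" if x: "x \<in> verts G" "x \<noteq> v" for x
  proof -
    obtain n where n: "d x = Suc n"
      using reach[OF x(1)] x(2) by (cases "d x") auto
    then obtain p where p: "(v, p) \<in> arcs_ends G ^^ n" "p \<rightarrow> x"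
      using reach[OF x(1)] by auto
    then have "d x = Suc (d p)" using d_le[OF p(1)] d_step[OF p(2)] n by simp
    with p show ?thesis by blast
  qed
  \<comment> \<open>Shortest paths to \<open>v\<close> from vertices no farther away than \<open>w\<close> avoid \<open>w\<close>; two such neighbours of \<open>w\<close>
    would thus lie on a cycle through \<open>w\<close>.\<close>
  have avoid: "v \<rightarrow>\<^sup>*\<^bsub>del_vert w\<^esub> a"
    if "w \<noteq> v" "a \<in> verts G" "a \<noteq> w" "d a \<le> d w" for a w
    using that(2-4)
  proof (induction "d a" arbitrary: a rule: less_induct)
    case less
    interpret D: wf_digraph "del_vert w" by (rule wf_digraph_del_vert)
    show ?case
    proof (cases "a = v")
      case True
      then show ?thesis using v that(1) by (auto simp: del_vert_simps)
    next
      case False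
      then obtain p where p: "p \<rightarrow> a" "d a = Suc (d p)" using parent less.prems by blast
      then have "p \<noteq> w" using less.prems by auto
      then have "v \<rightarrow>\<^sup>*\<^bsub>del_vert w\<^esub> p"
        using p less.prems adj_in_verts[OF p(1)] by (intro less.hyps) auto
      moreover have "p \<rightarrow>\<^bsub>del_vert w\<^esub> a"
        using p(1) \<open>p \<noteq> w\<close> less.prems by (auto simp: arcs_ends_conv del_vert_simps)
      ultimately show ?thesis by (rule D.reachable_adj_trans)
    qed
  qed
  have unique: "a = b" if w: "w \<rightarrow> a" "w \<rightarrow> b" "d a \<le> d w" "d b \<le> d w" for w a b
  proof (rule ccontr)
    assume "a \<noteq> b"
    interpret D: wf_digraph "del_vert w" by (rule wf_digraph_del_vert)
    have V: "a \<in> verts G" "b \<in> verts G" "a \<noteq> w" "b \<noteq> w"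
      using w(1,2) adj_in_verts adj_not_same by blast+
    have "w \<noteq> v"
      using w(3) V parent[of a] d_v by auto
    have "symmetric (del_vert w)"
      using dominates_sym by (auto simp: symmetric_conv arcs_ends_conv del_vert_simps)
    then have "a \<rightarrow>\<^sup>*\<^bsub>del_vert w\<^esub> b"
      using avoid[OF \<open>w \<noteq> v\<close> V(1,3) w(3)] avoid[OF \<open>w \<noteq> v\<close> V(2,4) w(4)]
      by (blast intro: symmetric_reachable D.reachable_trans)
    then obtain p where p: "D.apath a p b" unfolding D.reachable_apath by (rule exE)
    then have "set (D.awalk_verts a p) \<subseteq> verts (del_vert w)"
      unfolding D.apath_def D.awalk_conv by (elim conjE)
    then have w_notin: "w \<notin> set (D.awalk_verts a p)"
      by (auto simp: verts_del_vert)
    have verts_eq: "D.awalk_verts a p = awalk_verts a p"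
      by (simp add: pre_digraph.awalk_verts_conv del_vert_simps)
    have ap: "apath a p b" by (rule subgraph_apath_imp_apath[OF p subgraph_del_vert])
    obtain e where e: "e \<in> arcs G" "tail G e = w" "head G e = a" using w(1) by (auto simp: arcs_ends_conv)
    obtain e' where e': "e' \<in> arcs G" "tail G e' = b" "head G e' = w"
      using dominates_sym[OF w(2)] by (auto simp: arcs_ends_conv)
    have "awalk w (e # p @ [e']) w"
      using ap e e' adj_in_verts[OF w(1)] by (auto simp: apath_def awalk_simps)
    moreover have "awalk_verts w (e # p @ [e']) = w # awalk_verts a p @ [w]"
      using ap e e' by (auto simp: apath_def awalk_verts_append awalk_verts_conv)
    \<comment> \<open>At least one arc in \<open>p\<close> makes the closed walk through
      \<open>w\<close> have length at least 3, so it is not a mere back-and-forth along one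
      edge.\<close>
    moreover have "p \<noteq> []" using ap \<open>a \<noteq> b\<close> by (auto simp: apath_simps)
    ultimately have "cycle (e # p @ [e']) \<and> 3 \<le> length (e # p @ [e'])"
      unfolding cycle_def using ap w_notin verts_eq
      by (cases p) (auto simp: apath_def intro!: exI[of _ w])
    then show False using acyclic by blast
  qed
  have "layered_tree (verts G) (arcs_ends G) v d"
  proof
    show "d x = Suc (d y) \<or> d y = Suc (d x)" if xy: "x \<rightarrow> y" for x y
    proof -
      have "x \<noteq> y" using xy adj_not_same by blast
      \<comment> \<open>Otherwise \<open>y\<close> and the parent of \<open>x\<close> would be two
        different neighbours of \<open>x\<close> no farther from \<open>v\<close> than
        \<open>x\<close>.\<close>
      have "d x \<noteq> d y"
      proof
        assume eq: "d x = d y"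
        have "x \<noteq> v"
          using eq d_v parent[of y] adj_in_verts[OF xy] \<open>x \<noteq> y\<close> by auto
        then obtain p where "p \<rightarrow> x" "d x = Suc (d p)"
          using parent adj_in_verts[OF xy] by blast
        with unique[of x p y] xy eq dominates_sym show False by force
      qed
      then show ?thesis using d_step[OF xy] d_step[OF dominates_sym[OF xy]] by linarith
    qed
    show "p = q" if "p \<rightarrow> x" "q \<rightarrow> x" "d x = Suc (d p)" "d x = Suc (d q)" for p q x
      using unique[of x p q] that dominates_sym by simp
  qed (use v d_v parent adj_in_verts dominates_sym in auto)
  then show ?thesis by blast
qed

lemma digraph_iso_path_graph_3:
  assumes "verts G = {v, a, b}" "v \<noteq> a" "v \<noteq> b" "a \<noteq> b"
    and "arcs_ends G = {(v, a), (a, v), (v, b), (b, v)}"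
  shows "digraph_iso G (with_proj (path_graph 3))"
proof -
  \<comment> \<open>The vertex \<open>v\<close> is the middle of the path and goes to 1; the default
    value 2 serves \<open>b\<close>.\<close>
  define \<phi> :: "'a \<Rightarrow> nat" where "\<phi> x = (if x = a then 0 else if x = v then 1 else 2)" for x
  define h where "h = \<lparr>iso_verts = \<phi>, iso_arcs = (\<lambda>e. (\<phi> (tail G e), \<phi> (head G e))),
    iso_head = snd, iso_tail = fst\<rparr>"
  have inj: "inj_on \<phi> (verts G)" using assms by (auto simp: inj_on_def \<phi>_def)
  then have "inj_on (\<lambda>e. (\<phi> (tail G e), \<phi> (head G e))) (arcs G)"
    by (auto simp: inj_on_def arc_to_ends_def intro!: no_multi_arcs)
  with inj have "digraph_isomorphism h"
    using wf_digraph by (auto simp: digraph_isomorphism_def h_def)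
  moreover have "(\<lambda>e. (\<phi> (tail G e), \<phi> (head G e))) ` arcs G = map_prod \<phi> \<phi> ` arcs_ends G"
    by (simp add: arcs_ends_conv image_image)
  then have "(\<lambda>e. (\<phi> (tail G e), \<phi> (head G e))) ` arcs G = {(1, 0), (0, 1), (1, 2), (2, 1)}"
    using assms by (simp add: \<phi>_def)
  moreover have "parcs (path_graph 3) = {(1, 0), (0, 1), (1, 2), (2, 1)}"
    by (auto simp: path_graph_def)
  moreover have "\<phi> ` verts G = pverts (path_graph 3)"
    using assms by (auto simp: \<phi>_def path_graph_def)
  ultimately show ?thesis
    unfolding digraph_iso_def
    by (intro exI[of _ h]) (auto simp: app_iso_def h_def with_proj_def)
qed

end

theorem theorem3p3:
  fixes T :: "('a, 'b) pre_digraph" and v :: 'a and c :: color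
  assumes "undirected_tree T"
    and "subcubic T"
    and "\<not> digraph_iso T (with_proj (path_graph 3))"
    and "v \<in> verts T"
    and "out_degree T v = 2"
  shows "\<exists>f. crumby_coloring T f \<and> f v = c"
proof -
  interpret graph T using assms(1) by (simp add: undirected_tree_def)
  obtain d where "layered_tree (verts T) (arcs_ends T) v d"
    using layered_tree_distance assms(1,4) by (auto simp: undirected_tree_def)
  then interpret L: layered_tree "verts T" "arcs_ends T" v d .
  have deg: "card {y. (x, y) \<in> arcs_ends T} \<le> 3" if "x \<in> verts T" for x
    using assms(2) that by (simp add: subcubic_def max_degree_at_most_def out_degree_conv)
  have deg_v: "card {y. (v, y) \<in> arcs_ends T} = 2" using assms(5) by (simp add: out_degree_conv)
  \<comment> \<open>If both children of \<open>v\<close> were leaves, the tree would be a star with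
    two leaves, the excluded path.\<close>
  have "\<exists>y\<in>L.children v. L.children y \<noteq> {}"
  proof (rule ccontr)
    assume "\<not> ?thesis"
    then have star: "verts T = insert v (L.children v)" "arcs_ends T = {v} \<times> L.children v \<union> L.children v \<times> {v}"
      using L.star_if_leaves by blast+
    obtain a b where ab: "L.children v = {a, b}" "a \<noteq> b"
      using deg_v L.children_root by (auto simp: card_2_iff)
    then have "v \<noteq> a" "v \<noteq> b" using L.root_not_child by blast+
    then have "digraph_iso T (with_proj (path_graph 3))"
      using star ab by (intro digraph_iso_path_graph_3[of v a b]) auto
    then show False using assms(3) by blast
  qed
  then obtain y where "y \<in> L.children v" "L.children y \<noteq> {}" by blast
  from L.ex_root_labelling[OF deg deg_v this] obtain g
    where g: "\<And>x. x \<in> verts T \<Longrightarrow> consistent (g x) (L.children x) g" "g v \<noteq> R0" and c: "L.state_color g v = c"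
    by blast
  have "crumby_coloring T (L.state_color g)"
  proof (rule crumby_coloringI)
    show "\<exists>y. x \<rightarrow>\<^bsub>T\<^esub> y \<and> L.state_color g y = Red" if "x \<in> verts T" "L.state_color g x = Red" for x
      using L.red_ex[OF g] that by blast
    show "y = z" if "x \<rightarrow>\<^bsub>T\<^esub> y" "x \<rightarrow>\<^bsub>T\<^esub> z" "L.state_color g x = Blue" "L.state_color g y = Blue" "L.state_color g z = Blue"
      for x y z using L.blue_unique[OF g] that by blast
    show "w = y \<or> x = z" if "w \<rightarrow>\<^bsub>T\<^esub> x" "x \<rightarrow>\<^bsub>T\<^esub> y" "y \<rightarrow>\<^bsub>T\<^esub> z"
      "L.state_color g w = Red" "L.state_color g x = Red" "L.state_color g y = Red" "L.state_color g z = Red" for w x y z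
      \<comment> \<open>One end of the middle edge is a leaf of its star, so its two red neighbours
        on the walk coincide.\<close>
      using L.red_edge[OF g that(2,5,6)] L.red_unique[OF g, of x w y] L.red_unique[OF g, of y x z]
        that dominates_sym by blast
  qed
  with c show ?thesis by blast
qed

end
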